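(* Consider the one-dimensional all-topology two-fluid system described in the context. For the genuinely non-linear (acoustic) waves, two states connected through a shock propagating at speed $\sigma$ satisfy the jump conditions $$[\![\alpha_1]\!]=0,$$ and, for $k=1,2$, $$[\![\alpha_k\rho_k(u_k-\sigma)]\!]=0,$$ $$[\![\alpha_k\rho_ku_k(u_k-\sigma)]\!]+[\![\alpha_kp_k]\!]=0,$$ $$[\![\alpha_k\rho_kE_k(u_k-\sigma)]\!]+[\![\alpha_kp_ku_k]\!]=0,$$ where $[\![\phi]\!]$ denotes the jump of $\phi$ through the discontinuity.
   Context: Thermodynamics: for each phase $k=1,2$ a complete equation of state is given by a smooth strictly concave function $(\tau_k,e_k)\mapsto s_k$, where $\rho_k>0$ is the density, $\tau_k=1/\rho_k$ the specific volume, $e_k$ the specific internal energy and $s_k$ the specific entropy. The Gibbs identity $T_k\,\mathrm{d}s_k=\mathrm{d}e_k+p_k\,\mathrm{d}\tau_k$ defines the temperature $T_k>0$ and the pressure $p_k$. The sound velocity is $c_k=\sqrt{\left.\partial p_k/\partial\rho_k\right|_{s_k}}>0$. Notation: $u_k\in\mathbb{R}$ is the velocity of phase $k$; $\alpha_1\in(0,1)$ is the volume fraction of phase 1 and $\alpha_2=1-\alpha_1$; $\rho=\alpha_1\rho_1+\alpha_2\rho_2$; $Y_k=\alpha_k\rho_k/\rho$; $u=Y_1u_1+Y_2u_2$; $E_k=e_k+u_k^2/2$; $H_k=E_k+p_k/\rho_k$; interfacial pressure $p_I=Y_2p_1+Y_1p_2$; interfacial work $(pu)_I=Y_1p_2u_1+Y_2p_1u_2$.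 System (one space dimension, no source terms): $$\partial_t\alpha_1+u\,\partial_x\alpha_1=0,$$ $$\partial_t(\alpha_k\rho_k)+\partial_x(\alpha_k\rho_ku_k)=0,\quad k=1,2,$$ $$\partial_t(\alpha_1\rho_1u_1)+\partial_x(\alpha_1\rho_1u_1^2+\alpha_1p_1)-p_I\partial_x\alpha_1=0,$$ $$\partial_t(\alpha_2\rho_2u_2)+\partial_x(\alpha_2\rho_2u_2^2+\alpha_2p_2)+p_I\partial_x\alpha_1=0,$$ $$\partial_t(\alpha_1\rho_1E_1)+\partial_x(\alpha_1\rho_1H_1u_1)-(pu)_I\partial_x\alpha_1=0,$$ $$\partial_t(\alpha_2\rho_2E_2)+\partial_x(\alpha_2\rho_2H_2u_2)+(pu)_I\partial_x\alpha_1=0.$$ The eigenvalues of the system are $u$, $u_k$ (linearly degenerate fields) and $u_k\pm c_k$, $k=1,2$ (genuinely non-linear fields, for equations of state with non-vanishing fundamental derivative $-\tfrac{\tau_k}{2}\,\partial^3_{\tau_k}e_k|_{s_k}/\partial^2_{\tau_k}e_k|_{s_k}$). A shock propagating at speed $\sigma$ is a solution consisting of two constant states separated by the line $x=\sigma t$ and associated with one of the genuinely non-linear fields. The volume fraction varies only through the interfacial wave (the linearly degenerate field of eigenvalue $u$) and is constant on each side of it. Hence across a shock $\alpha_1$ is constant, the non-conservative products, all of which involve $\partial_x\alpha_1$, are inactive, and the solution is understood in the sense of distributions for the resulting system of conservation laws. *)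

theory Defs
  imports "HOL-Analysis.Analysis"
begin

section \<open>Smooth functions\<close>

fun Ck_on :: "nat \<Rightarrow> 'a::real_normed_vector set \<Rightarrow> ('a \<Rightarrow> real) \<Rightarrow> bool" where
  "Ck_on 0 S f \<longleftrightarrow> continuous_on S f"
| "Ck_on (Suc n) S f \<longleftrightarrow>
     (\<forall>x\<in>S. f differentiable (at x)) \<and>
     (\<forall>v. Ck_on n S (\<lambda>x. frechet_derivative f (at x) v))"

definition smooth_on :: "'a::real_normed_vector set \<Rightarrow> ('a \<Rightarrow> real) \<Rightarrow> bool" where
  "smooth_on S f \<longleftrightarrow> (\<forall>n. Ck_on n S f)"

text \<open>Partial derivatives of a function on the plane with respect to the first and the
  second variable.\<close>

definition partial1 :: "(real \<times> real \<Rightarrow> real) \<Rightarrow> real \<times> real \<Rightarrow> real" where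
  "partial1 f z = frechet_derivative f (at z) (1, 0)"

definition partial2 :: "(real \<times> real \<Rightarrow> real) \<Rightarrow> real \<times> real \<Rightarrow> real" where
  "partial2 f z = frechet_derivative f (at z) (0, 1)"


section \<open>Thermodynamics of one phase\<close>

text \<open>The entropy is a function of the pair (specific volume, specific internal energy).\<close>

record eos =
  eos_dom :: "(real \<times> real) set"
  entropy :: "real \<times> real \<Rightarrow> real"

text \<open>Temperature and pressure are read off the Gibbs identity
  \<open>T ds = de + p d\<tau>\<close>, that is \<open>\<partial>s/\<partial>e = 1/T\<close> and \<open>\<partial>s/\<partial>\<tau> = p/T\<close>;
  see lemma \<open>gibbs_identity\<close> below.\<close>

definition temperature :: "eos \<Rightarrow> real \<times> real \<Rightarrow> real" where
  "temperature E z = 1 / partial2 (entropy E) z"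

definition pressure :: "eos \<Rightarrow> real \<times> real \<Rightarrow> real" where
  "pressure E z = temperature E z * partial1 (entropy E) z"

text \<open>The internal energy as a function of specific volume and entropy. It is uniquely determined
  because the entropy is strictly increasing in \<open>e\<close>.\<close>

definition energy_of :: "eos \<Rightarrow> real \<Rightarrow> real \<Rightarrow> real" where
  "energy_of E \<tau> s = (THE e. (\<tau>, e) \<in> eos_dom E \<and> entropy E (\<tau>, e) = s)"

definition isentropic_pressure :: "eos \<Rightarrow> real \<Rightarrow> real \<Rightarrow> real" where
  "isentropic_pressure E s \<rho> = pressure E (1 / \<rho>, energy_of E (1 / \<rho>) s)"

definition sound_velocity :: "eos \<Rightarrow> real \<times> real \<Rightarrow> real" where
  "sound_velocity E z = sqrt (deriv (isentropic_pressure E (entropy E z)) (1 / fst z))"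

definition fundamental_derivative :: "eos \<Rightarrow> real \<times> real \<Rightarrow> real" where
  "fundamental_derivative E z =
     - (fst z / 2) * (deriv ^^ 3) (\<lambda>\<tau>. energy_of E \<tau> (entropy E z)) (fst z)
                   / (deriv ^^ 2) (\<lambda>\<tau>. energy_of E \<tau> (entropy E z)) (fst z)"

definition strictly_concave_on :: "'a::real_vector set \<Rightarrow> ('a \<Rightarrow> real) \<Rightarrow> bool" where
  "strictly_concave_on S f \<longleftrightarrow> convex S \<and>
     (\<forall>x\<in>S. \<forall>y\<in>S. \<forall>t. x \<noteq> y \<and> 0 < t \<and> t < 1 \<longrightarrow>
        (1 - t) * f x + t * f y < f ((1 - t) *\<^sub>R x + t *\<^sub>R y))"

definition complete_eos :: "eos \<Rightarrow> bool" where
  "complete_eos E \<longleftrightarrow>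
     open (eos_dom E) \<and> eos_dom E \<subseteq> {0<..} \<times> UNIV \<and>
     smooth_on (eos_dom E) (entropy E) \<and>
     strictly_concave_on (eos_dom E) (entropy E) \<and>
     (\<forall>z \<in> eos_dom E. 0 < temperature E z \<and> 0 < sound_velocity E z)"

definition nonvanishing_fundamental_derivative :: "eos \<Rightarrow> bool" where
  "nonvanishing_fundamental_derivative E \<longleftrightarrow>
     (\<forall>z \<in> eos_dom E. fundamental_derivative E z \<noteq> 0)"

lemma gibbs_identity:
  assumes "complete_eos E" "z \<in> eos_dom E"
  shows "temperature E z * frechet_derivative (entropy E) (at z) (d\<tau>, de)
           = de + pressure E z * d\<tau>"
proof -
  let ?D = "frechet_derivative (entropy E) (at z)"
  have "Ck_on (Suc 0) (eos_dom E) (entropy E)"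
    using assms unfolding complete_eos_def smooth_on_def by blast
  then have "entropy E differentiable (at z)" using assms by simp
  then have lin: "linear ?D" by (rule linear_frechet_derivative)
  have "?D (d\<tau>, de) = ?D (d\<tau> *\<^sub>R (1, 0) + de *\<^sub>R (0, 1))" by simp
  also have "\<dots> = d\<tau> * ?D (1, 0) + de * ?D (0, 1)"
    by (simp only: linear_add[OF lin] linear_scale[OF lin] real_scaleR_def)
  finally have eq: "?D (d\<tau>, de) = d\<tau> * ?D (1, 0) + de * ?D (0, 1)" .
  have "0 < temperature E z" using assms unfolding complete_eos_def by blast
  then have "?D (0, 1) \<noteq> 0" unfolding temperature_def partial2_def by auto
  then show ?thesis
    by (simp add: eq pressure_def temperature_def partial1_def partial2_def field_simps)
qed


section \<open>States of the two-fluid model\<close>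

datatype phase = Phase1 | Phase2


record state =
  vf1 :: real
  dens :: "phase \<Rightarrow> real"
  vel :: "phase \<Rightarrow> real"
  inte :: "phase \<Rightarrow> real"

fun vf :: "state \<Rightarrow> phase \<Rightarrow> real" where
  "vf U Phase1 = vf1 U"
| "vf U Phase2 = 1 - vf1 U"

definition thermo_point :: "state \<Rightarrow> phase \<Rightarrow> real \<times> real" where
  "thermo_point U k = (1 / dens U k, inte U k)"

definition admissible :: "(phase \<Rightarrow> eos) \<Rightarrow> state \<Rightarrow> bool" where
  "admissible E U \<longleftrightarrow> 0 < vf1 U \<and> vf1 U < 1 \<and>
     (\<forall>k. 0 < dens U k \<and> thermo_point U k \<in> eos_dom (E k))"

definition pres :: "(phase \<Rightarrow> eos) \<Rightarrow> state \<Rightarrow> phase \<Rightarrow> real" where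
  "pres E U k = pressure (E k) (thermo_point U k)"

definition sound :: "(phase \<Rightarrow> eos) \<Rightarrow> state \<Rightarrow> phase \<Rightarrow> real" where
  "sound E U k = sound_velocity (E k) (thermo_point U k)"

definition mix_dens :: "state \<Rightarrow> real" where
  "mix_dens U = vf U Phase1 * dens U Phase1 + vf U Phase2 * dens U Phase2"

definition mass_frac :: "state \<Rightarrow> phase \<Rightarrow> real" where
  "mass_frac U k = vf U k * dens U k / mix_dens U"

definition mix_vel :: "state \<Rightarrow> real" where
  "mix_vel U = mass_frac U Phase1 * vel U Phase1 + mass_frac U Phase2 * vel U Phase2"

definition total_energy :: "state \<Rightarrow> phase \<Rightarrow> real" where
  "total_energy U k = inte U k + (vel U k)\<^sup>2 / 2"

definition total_enthalpy :: "(phase \<Rightarrow> eos) \<Rightarrow> state \<Rightarrow> phase \<Rightarrow> real" where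
  "total_enthalpy E U k = total_energy U k + pres E U k / dens U k"

definition interf_pres :: "(phase \<Rightarrow> eos) \<Rightarrow> state \<Rightarrow> real" where
  "interf_pres E U = mass_frac U Phase2 * pres E U Phase1 + mass_frac U Phase1 * pres E U Phase2"

definition interf_work :: "(phase \<Rightarrow> eos) \<Rightarrow> state \<Rightarrow> real" where
  "interf_work E U = mass_frac U Phase1 * pres E U Phase2 * vel U Phase1
                   + mass_frac U Phase2 * pres E U Phase1 * vel U Phase2"


section \<open>The system\<close>

text \<open>Each of the seven equations has the form
  \<open>\<partial>\<^sub>t w + \<partial>\<^sub>x f + b \<partial>\<^sub>x \<alpha>\<^sub>1 = 0\<close> with \<open>w\<close>, \<open>f\<close> and \<open>b\<close> functions of the state.\<close>

datatype equation = VolumeFraction | Mass phase | Momentum phase | Energy phase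

fun conserved :: "equation \<Rightarrow> state \<Rightarrow> real" where
  "conserved VolumeFraction U = vf1 U"
| "conserved (Mass k) U = vf U k * dens U k"
| "conserved (Momentum k) U = vf U k * dens U k * vel U k"
| "conserved (Energy k) U = vf U k * dens U k * total_energy U k"

fun flux :: "(phase \<Rightarrow> eos) \<Rightarrow> equation \<Rightarrow> state \<Rightarrow> real" where
  "flux E VolumeFraction U = 0"
| "flux E (Mass k) U = vf U k * dens U k * vel U k"
| "flux E (Momentum k) U = vf U k * dens U k * (vel U k)\<^sup>2 + vf U k * pres E U k"
| "flux E (Energy k) U = vf U k * dens U k * total_enthalpy E U k * vel U k"

fun nc_coeff :: "(phase \<Rightarrow> eos) \<Rightarrow> equation \<Rightarrow> state \<Rightarrow> real" where
  "nc_coeff E VolumeFraction U = mix_vel U"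
| "nc_coeff E (Mass k) U = 0"
| "nc_coeff E (Momentum Phase1) U = - interf_pres E U"
| "nc_coeff E (Momentum Phase2) U = interf_pres E U"
| "nc_coeff E (Energy Phase1) U = - interf_work E U"
| "nc_coeff E (Energy Phase2) U = interf_work E U"


section \<open>Discontinuities\<close>

text \<open>Space-time points are pairs \<open>(t, x)\<close>.\<close>

definition two_state :: "state \<Rightarrow> state \<Rightarrow> real \<Rightarrow> real \<times> real \<Rightarrow> state" where
  "two_state UL UR \<sigma> z = (if snd z < \<sigma> * fst z then UL else UR)"

definition test_function :: "(real \<times> real \<Rightarrow> real) \<Rightarrow> bool" where
  "test_function \<phi> \<longleftrightarrow> smooth_on UNIV \<phi> \<and>
     (\<exists>K. compact K \<and> K \<subseteq> {0<..} \<times> UNIV \<and> (\<forall>z. z \<notin> K \<longrightarrow> \<phi> z = 0))"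

text \<open>A piecewise constant solution, in the sense of distributions on \<open>{t > 0}\<close>. Its volume
  fraction satisfies \<open>\<partial>\<^sub>x \<alpha>\<^sub>1 = (\<alpha>\<^sub>1 UR - \<alpha>\<^sub>1 UL) \<delta>\<close> with \<open>\<delta>\<close> the Dirac mass on the line
  \<open>x = \<sigma> t\<close>. The product \<open>b \<partial>\<^sub>x \<alpha>\<^sub>1\<close> therefore needs a value of \<open>b\<close> on that line, which the states
  alone do not determine when \<open>\<alpha>\<^sub>1\<close> jumps; the parameter \<open>m\<close> is an arbitrary rule providing it
  (for instance the mean value of \<open>b\<close> along a path from \<open>UL\<close> to \<open>UR\<close>). When \<open>\<alpha>\<^sub>1\<close> does not jump
  the right-hand side is zero, and what remains is the distributional formulation of a system of
  conservation laws.\<close>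

definition two_state_solution ::
  "(phase \<Rightarrow> eos) \<Rightarrow> ((state \<Rightarrow> real) \<Rightarrow> state \<Rightarrow> state \<Rightarrow> real) \<Rightarrow> state \<Rightarrow> state \<Rightarrow> real \<Rightarrow> bool" where
  "two_state_solution E m UL UR \<sigma> \<longleftrightarrow>
     (\<forall>q \<phi>. test_function \<phi> \<longrightarrow>
        (LINT z|lborel. conserved q (two_state UL UR \<sigma> z) * partial1 \<phi> z
                      + flux E q (two_state UL UR \<sigma> z) * partial2 \<phi> z)
        = m (nc_coeff E q) UL UR * (vf1 UR - vf1 UL) * (LINT t|lborel. \<phi> (t, \<sigma> * t)))"


section \<open>Characteristic fields and shocks\<close>

datatype wave_field = Interfacial | Contact phase | AcousticMinus phase | AcousticPlus phase

fun eigenvalue :: "(phase \<Rightarrow> eos) \<Rightarrow> wave_field \<Rightarrow> state \<Rightarrow> real" where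
  "eigenvalue E Interfacial U = mix_vel U"
| "eigenvalue E (Contact k) U = vel U k"
| "eigenvalue E (AcousticMinus k) U = vel U k - sound E U k"
| "eigenvalue E (AcousticPlus k) U = vel U k + sound E U k"

fun acoustic :: "wave_field \<Rightarrow> bool" where
  "acoustic Interfacial = False"
| "acoustic (Contact k) = False"
| "acoustic (AcousticMinus k) = True"
| "acoustic (AcousticPlus k) = True"

definition state_tendsto :: "(nat \<Rightarrow> state) \<Rightarrow> state \<Rightarrow> bool" where
  "state_tendsto V U \<longleftrightarrow> (\<lambda>n. vf1 (V n)) \<longlonglongrightarrow> vf1 U \<and>
     (\<forall>k. (\<lambda>n. dens (V n) k) \<longlonglongrightarrow> dens U k \<and> (\<lambda>n. vel (V n) k) \<longlonglongrightarrow> vel U k \<and>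
          (\<lambda>n. inte (V n) k) \<longlonglongrightarrow> inte U k)"

text \<open>\<open>W i UL UR \<sigma>\<close> is read as: the discontinuity between \<open>UL\<close> and \<open>UR\<close> of speed \<open>\<sigma>\<close> is
  associated with the field \<open>i\<close>. The relation is kept general, since the full system is not
  conservative and a choice of wave curves depends on how the nonconservative products are defined.
  What is required of it is, in this order: discontinuities of the linearly degenerate fields are
  contacts; the speed of a discontinuity of a genuinely nonlinear field tends to the eigenvalue of
  that field when the amplitude vanishes; the volume fraction varies only through the interfacial
  wave.\<close>

definition wave_association ::
  "(phase \<Rightarrow> eos) \<Rightarrow> (wave_field \<Rightarrow> state \<Rightarrow> state \<Rightarrow> real \<Rightarrow> bool) \<Rightarrow> bool" where
  "wave_association E W \<longleftrightarrow>
     (\<forall>i UL UR \<sigma>. \<not> acoustic i \<and> admissible E UL \<and> admissible E UR \<and> W i UL UR \<sigma> \<longrightarrow>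
        eigenvalue E i UL = \<sigma> \<and> eigenvalue E i UR = \<sigma>) \<and>
     (\<forall>i U V \<sigma>. acoustic i \<and> admissible E U \<and> (\<forall>n. admissible E (V n) \<and> W i U (V n) (\<sigma> n)) \<and>
        state_tendsto V U \<longrightarrow> \<sigma> \<longlonglongrightarrow> eigenvalue E i U) \<and>
     (\<forall>i UL UR \<sigma>. admissible E UL \<and> admissible E UR \<and> W i UL UR \<sigma> \<and> vf1 UL \<noteq> vf1 UR \<longrightarrow>
        i = Interfacial)"

definition shock ::
  "(phase \<Rightarrow> eos) \<Rightarrow> ((state \<Rightarrow> real) \<Rightarrow> state \<Rightarrow> state \<Rightarrow> real) \<Rightarrow>
   (wave_field \<Rightarrow> state \<Rightarrow> state \<Rightarrow> real \<Rightarrow> bool) \<Rightarrow> state \<Rightarrow> state \<Rightarrow> real \<Rightarrow> bool" where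
  "shock E m W UL UR \<sigma> \<longleftrightarrow>
     admissible E UL \<and> admissible E UR \<and> two_state_solution E m UL UR \<sigma> \<and>
     (\<exists>i. acoustic i \<and> W i UL UR \<sigma>)"

definition jump :: "state \<Rightarrow> state \<Rightarrow> (state \<Rightarrow> real) \<Rightarrow> real" where
  "jump UL UR g = g UR - g UL"

end

theory Submission
  imports Defs
begin

text \<open>The volume fraction does not jump across an acoustic wave, so the system is conservative there
  and each equation yields \<open>[flux] = \<sigma> [conserved]\<close> by testing the weak formulation against
  \<open>a t * b (x - \<sigma> * t)\<close> with smooth bump functions \<open>a\<close> and \<open>b\<close>: the contribution of \<open>a'\<close> integrates
  to zero in \<open>t\<close>, and that of \<open>b'\<close> isolates the jump across \<open>x = \<sigma> * t\<close>.\<close>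

section \<open>Calculus of \<open>Ck_on\<close>\<close>

text \<open>Differentiability gives continuity at the base, and the induction lowers the order of
  every directional derivative. The product rule needs this: it leaves one factor undifferentiated
  while the order drops.\<close>

lemma Ck_on_SucD: "Ck_on (Suc n) S f \<Longrightarrow> Ck_on n S f"
proof (induction n arbitrary: f)
  case 0
  then show ?case
    by (auto intro!: continuous_at_imp_continuous_on differentiable_imp_continuous_within)
next
  case (Suc n)
  have "Ck_on (Suc n) S (\<lambda>x. frechet_derivative f (at x) v)" for v
    using Suc.prems by (subst (asm) Ck_on.simps) blast
  then have "Ck_on n S (\<lambda>x. frechet_derivative f (at x) v)" for v
    by (rule Suc.IH)
  with Suc.prems show ?case by simp
qed

text \<open>On an open set, agreement at the points of \<open>S\<close> is agreement near each of
  them, so the derivatives agree on \<open>S\<close> too. This lets an explicit derivative replace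
  \<open>frechet_derivative\<close>, which is controlled only on \<open>S\<close>.\<close>

lemma Ck_on_cong:
  assumes "open S" "Ck_on n S f" "\<And>x. x \<in> S \<Longrightarrow> f x = g x"
  shows "Ck_on n S g"
  using assms(2,3)
proof (induction n arbitrary: f g)
  case 0
  then show ?case by (metis Ck_on.simps(1) continuous_on_cong)
next
  case (Suc n)
  have g: "(g has_derivative frechet_derivative f (at x)) (at x)" if "x \<in> S" for x
  proof (rule has_derivative_transform_within_open[OF _ assms(1) that])
    show "(f has_derivative frechet_derivative f (at x)) (at x)"
      using Suc.prems(1) that by (simp add: frechet_derivative_works)
  qed (use Suc.prems in auto)
  have "Ck_on n S (\<lambda>x. frechet_derivative g (at x) v)" for v
  proof (rule Suc.IH)
    show "Ck_on n S (\<lambda>x. frechet_derivative f (at x) v)" using Suc.prems(1) by simp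
    show "frechet_derivative f (at x) v = frechet_derivative g (at x) v" if "x \<in> S" for x
      using frechet_derivative_at[OF g[OF that]] by simp
  qed
  moreover have "\<forall>x\<in>S. g differentiable (at x)"
    using g by (auto simp: differentiable_def)
  ultimately show ?case by simp
qed

lemma Ck_on_SucI:
  assumes "open S" "\<And>x. x \<in> S \<Longrightarrow> (f has_derivative D x) (at x)"
    and "\<And>v. Ck_on n S (\<lambda>x. D x v)"
  shows "Ck_on (Suc n) S f"
proof -
  have "Ck_on n S (\<lambda>x. frechet_derivative f (at x) v)" for v
    by (rule Ck_on_cong[OF assms(1) assms(3)[of v]])
       (simp add: frechet_derivative_at[OF assms(2), symmetric])
  then show ?thesis using assms(2) by (auto simp: differentiable_def)
qed

lemma Ck_on_SucE:
  assumes "Ck_on (Suc n) S f"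
  obtains D where "\<And>x. x \<in> S \<Longrightarrow> (f has_derivative D x) (at x)"
    "\<And>v. Ck_on n S (\<lambda>x. D x v)"
  using assms that[of "\<lambda>x. frechet_derivative f (at x)"] by (simp add: frechet_derivative_works)

lemma Ck_on_add:
  assumes "open S" "Ck_on n S f" "Ck_on n S g"
  shows "Ck_on n S (\<lambda>x. f x + g x)"
  using assms(2,3)
proof (induction n arbitrary: f g)
  case 0
  then show ?case by (simp add: continuous_on_add)
next
  case (Suc n)
  obtain F where F: "\<And>x. x \<in> S \<Longrightarrow> (f has_derivative F x) (at x)" "\<And>v. Ck_on n S (\<lambda>x. F x v)"
    by (rule Ck_on_SucE[OF Suc.prems(1)]) blast
  obtain G where G: "\<And>x. x \<in> S \<Longrightarrow> (g has_derivative G x) (at x)" "\<And>v. Ck_on n S (\<lambda>x. G x v)"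
    by (rule Ck_on_SucE[OF Suc.prems(2)]) blast
  show ?case
    by (rule Ck_on_SucI[OF assms(1) has_derivative_add[OF F(1) G(1)]]) (auto intro: Suc.IH F G)
qed

lemma Ck_on_mult:
  assumes "open S" "Ck_on n S f" "Ck_on n S g"
  shows "Ck_on n S (\<lambda>x. f x * g x)"
  using assms(2,3)
proof (induction n arbitrary: f g)
  case 0
  then show ?case by (simp add: continuous_on_mult)
next
  case (Suc n)
  obtain F where F: "\<And>x. x \<in> S \<Longrightarrow> (f has_derivative F x) (at x)" "\<And>v. Ck_on n S (\<lambda>x. F x v)"
    by (rule Ck_on_SucE[OF Suc.prems(1)]) blast
  obtain G where G: "\<And>x. x \<in> S \<Longrightarrow> (g has_derivative G x) (at x)" "\<And>v. Ck_on n S (\<lambda>x. G x v)"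
    by (rule Ck_on_SucE[OF Suc.prems(2)]) blast
  show ?case
    by (rule Ck_on_SucI[OF assms(1) has_derivative_mult[OF F(1) G(1)]])
       (auto intro!: Ck_on_add assms(1) Suc.IH F G Suc.prems[THEN Ck_on_SucD])
qed

lemma Ck_on_const: "open S \<Longrightarrow> Ck_on n S (\<lambda>x. c)"
proof (induction n arbitrary: c)
  case (Suc n)
  then show ?case by (intro Ck_on_SucI[where D = "\<lambda>x v. 0"]) auto
qed simp

text \<open>The inner derivative is the constant map \<open>L\<close>, so differentiating in
  direction \<open>v\<close> gives a derivative of \<open>f\<close> in the fixed direction
  \<open>L v\<close>, composed with the same affine map; the induction hypothesis applies at
  once.\<close>

lemma Ck_on_compose_affine:
  assumes "bounded_linear L" "Ck_on n UNIV f"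
  shows "Ck_on n UNIV (\<lambda>z. f (L z + c))"
  using assms(2)
proof (induction n arbitrary: f)
  case 0
  then show ?case
    by (auto intro!: continuous_on_compose2[of UNIV f] continuous_intros
        bounded_linear.continuous_on[OF assms(1)])
next
  case (Suc n)
  obtain D where D: "\<And>x. (f has_derivative D x) (at x)" "\<And>v. Ck_on n UNIV (\<lambda>x. D x v)"
    by (rule Ck_on_SucE[OF Suc.prems]) blast
  show ?case
  proof (rule Ck_on_SucI)
    show "((\<lambda>z. f (L z + c)) has_derivative (\<lambda>v. D (L z + c) (L v))) (at z)" for z
      by (rule has_derivative_compose[where f = "\<lambda>z. L z + c" and g = f])
         (auto intro!: derivative_eq_intros bounded_linear_imp_has_derivative assms(1) D)
  qed (auto intro: Suc.IH D)
qed

lemma smooth_on_mult: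
  "open S \<Longrightarrow> smooth_on S f \<Longrightarrow> smooth_on S g \<Longrightarrow> smooth_on S (\<lambda>x. f x * g x)"
  by (simp add: smooth_on_def Ck_on_mult)

lemma smooth_on_compose_affine:
  "bounded_linear L \<Longrightarrow> smooth_on UNIV f \<Longrightarrow> smooth_on UNIV (\<lambda>z. f (L z + c))"
  by (simp add: smooth_on_def Ck_on_compose_affine)

section \<open>A smooth bump function\<close>

text \<open>The derivatives of \<open>exp (- 1 / x)\<close> are again of the form \<open>poly p (1 / x) * exp (- 1 / x)\<close>,
  so this family is closed under differentiation.\<close>

definition flat :: "real poly \<Rightarrow> real \<Rightarrow> real" where
  "flat p x = (if 0 < x then poly p (1 / x) * exp (- (1 / x)) else 0)"

lemma poly_times_exp_minus_tendsto_0: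
  "((\<lambda>y::real. poly p y * exp (- y)) \<longlongrightarrow> 0) at_top"
proof -
  have "((\<lambda>y::real. \<Sum>i\<le>degree p. coeff p i * (y ^ i / exp y)) \<longlongrightarrow> (\<Sum>i\<le>degree p. coeff p i * 0)) at_top"
    by (intro tendsto_intros tendsto_power_div_exp_0)
  then show ?thesis
    by (simp add: poly_altdef exp_minus sum_distrib_right divide_inverse mult.assoc)
qed

text \<open>From the right, \<open>y = 1 / x\<close> turns this into exponential decay beating a
  polynomial at infinity; from the left \<open>flat p\<close> is zero.\<close>

lemma flat_tendsto_0: "(flat p \<longlongrightarrow> 0) (at 0)"
proof -
  have "((\<lambda>x. poly p (inverse x) * exp (- inverse x)) \<longlongrightarrow> 0) (at_right (0::real))"
    by (rule filterlim_compose[OF poly_times_exp_minus_tendsto_0 filterlim_inverse_at_top_right])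
  then have "(flat p \<longlongrightarrow> 0) (at_right 0)"
    by (rule Lim_transform_eventually)
       (auto simp: eventually_at_filter flat_def inverse_eq_divide)
  moreover have "(flat p \<longlongrightarrow> 0) (at_left 0)"
    by (rule tendsto_eventually) (auto simp: eventually_at_filter flat_def)
  ultimately show ?thesis by (simp add: filterlim_split_at)
qed

text \<open>With \<open>y = 1 / x\<close>, the chain rule contributes the factor
  \<open>- y^2\<close>, encoded by \<open>[:0, 0, 1:]\<close>; the sign is absorbed in
  \<open>p - pderiv p\<close>.\<close>

lemma flat_has_real_derivative:
  "(flat p has_real_derivative flat ([:0, 0, 1:] * (p - pderiv p)) x) (at x)"
proof -
  consider "x < 0" | "x = 0" | "0 < x" by linarith
  then show ?thesis
  proof cases
    case 1
    have "(flat p has_real_derivative 0) (at x)"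
      by (rule has_field_derivative_transform_within_open[where f = "\<lambda>x. 0" and S = "{..<0}"])
         (use 1 in \<open>auto simp: flat_def\<close>)
    with 1 show ?thesis by (simp add: flat_def)
  next
    case 2
    \<comment> \<open>Dividing by \<open>h\<close> multiplies the polynomial by its variable, so the
      difference quotient stays in the family. At \<open>h = 0\<close> both sides are 0, by the
      convention for division by zero.\<close>
    have "(\<lambda>h. (flat p (0 + h) - flat p 0) / h) = flat (pCons 0 p)"
      by (auto simp: flat_def)
    with 2 show ?thesis
      using flat_tendsto_0[of "pCons 0 p"] by (simp add: DERIV_def) (simp add: flat_def)
  next
    case 3
    have "((\<lambda>x. poly p (1 / x) * exp (- (1 / x))) has_real_derivative
        flat ([:0, 0, 1:] * (p - pderiv p)) x) (at x)"
      using 3 by (auto intro!: derivative_eq_intros poly_DERIV[THEN DERIV_chain2]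
          simp: flat_def field_simps power2_eq_square)
    then show ?thesis
      by (rule has_field_derivative_transform_within_open[where S = "{0<..}"])
         (use 3 in \<open>auto simp: flat_def\<close>)
  qed
qed

lemma smooth_on_flat: "smooth_on UNIV (flat p)"
proof -
  have "Ck_on n UNIV (flat p)" for n
  proof (induction n arbitrary: p)
    case 0
    then show ?case
      using flat_has_real_derivative by (auto intro!: DERIV_isCont continuous_at_imp_continuous_on)
  next
    case (Suc n)
    show ?case
      by (rule Ck_on_SucI[OF _ flat_has_real_derivative[unfolded has_field_derivative_def]])
         (auto intro!: Ck_on_mult Suc.IH Ck_on_const)
  qed
  then show ?thesis by (simp add: smooth_on_def)
qed

lemma smooth_bump_exists:
  obtains b :: "real \<Rightarrow> real" where "smooth_on UNIV b" "\<And>x. 0 \<le> b x"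
    "\<And>x. b x \<noteq> 0 \<longleftrightarrow> \<bar>x\<bar> < 1"
proof
  \<comment> \<open>The factors are positive exactly for \<open>x > -1\<close> and for
    \<open>x < 1\<close>.\<close>
  let ?b = "\<lambda>x. flat 1 (x + 1) * flat 1 (- x + 1)"
  show "smooth_on UNIV ?b"
    by (intro smooth_on_mult smooth_on_compose_affine smooth_on_flat bounded_linear_minus
        bounded_linear_ident open_UNIV)
qed (auto simp: flat_def)

section \<open>The Rankine-Hugoniot condition\<close>

lemma smooth_on_real_derivative:
  fixes f :: "real \<Rightarrow> real"
  assumes "smooth_on UNIV f"
  obtains f' where "\<And>x. (f has_real_derivative f' x) (at x)" "continuous_on UNIV f'"
proof -
  have "Ck_on (Suc 0) UNIV f" using assms by (simp only: smooth_on_def)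
  then obtain D where D: "\<And>x. (f has_derivative D x) (at x)" "\<And>v. Ck_on 0 UNIV (\<lambda>x. D x v)"
    by (rule Ck_on_SucE) blast
  show ?thesis
  proof
    show "(f has_real_derivative D x 1) (at x)" for x
      using D(1)[of x] has_derivative_bounded_linear[OF D(1)[of x]]
      by (metis has_derivative_imp_has_field_derivative mult.commute mult.right_neutral
          real_bounded_linear)
    show "continuous_on UNIV (\<lambda>x. D x 1)" using D(2) by simp
  qed
qed

lemma integrable_continuous_compact_support:
  fixes f :: "real \<Rightarrow> real"
  assumes "continuous_on UNIV f" "\<And>x. r < \<bar>x\<bar> \<Longrightarrow> f x = 0"
  shows "integrable lborel f"
proof -
  have "set_integrable lborel {-r..r} f"
    by (rule borel_integrable_atLeastAtMost') (use assms(1) continuous_on_subset in blast)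
  moreover have "(\<lambda>x. indicator {-r..r} x *\<^sub>R f x) = f"
    using assms(2) by (force simp: fun_eq_iff indicator_def)
  ultimately show ?thesis by (simp add: set_integrable_def)
qed

text \<open>For fixed \<open>t\<close> the change \<open>y = x - \<sigma> * t\<close> is a
  translation, which preserves Lebesgue measure; Fubini then separates the factors. In these
  coordinates the discontinuity is the line \<open>y = 0\<close>.\<close>

lemma sheared_product_integral:
  fixes p q :: "real \<Rightarrow> real"
  assumes p: "integrable lborel p" and q: "integrable lborel q"
  shows "integrable lborel (\<lambda>z. p (fst z) * q (snd z - \<sigma> * fst z))" (is "integrable _ ?h")
    and "(LINT z|lborel. p (fst z) * q (snd z - \<sigma> * fst z)) = (LINT t|lborel. p t) * (LINT y|lborel. q y)"
proof -
  \<comment> \<open>The version with absolute values serves the integrability hypothesis of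
    Fubini.\<close>
  have shift: "integrable lborel (\<lambda>x. q (x - c))" "(LINT x|lborel. q (x - c)) = (LINT y|lborel. q y)"
    "(LINT x|lborel. \<bar>q (x - c)\<bar>) = (LINT y|lborel. \<bar>q y\<bar>)" for c
    using lborel_integrable_real_affine[OF q, of 1 "- c"]
      lborel_integral_real_affine[of 1 q "- c"] lborel_integral_real_affine[of 1 "\<lambda>y. \<bar>q y\<bar>" "- c"]
    by simp_all
  have [measurable]: "p \<in> borel_measurable borel" "q \<in> borel_measurable borel"
    using p q by (auto dest: borel_measurable_integrable)
  have int: "integrable (lborel \<Otimes>\<^sub>M lborel) ?h"
  proof (rule lborel_pair.Fubini_integrable)
    show "?h \<in> borel_measurable (lborel \<Otimes>\<^sub>M lborel)" by measurable
    show "integrable lborel (\<lambda>t. LINT x|lborel. norm (?h (t, x)))"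
      using p by (simp add: abs_mult shift)
    show "AE t in lborel. integrable lborel (\<lambda>x. ?h (t, x))"
      by (simp add: shift)
  qed
  then show "integrable lborel ?h" by (simp add: lborel_prod)
  show "(LINT z|lborel. ?h z) = (LINT t|lborel. p t) * (LINT y|lborel. q y)"
    using lborel_pair.integral_fst'[OF int] by (simp add: lborel_prod shift)
qed

text \<open>The four constants are arbitrary reals, so one scalar statement covers every equation of
  the system.\<close>

lemma rankine_hugoniot:
  assumes weak: "\<And>\<phi>. test_function \<phi> \<Longrightarrow>
    (LINT z|lborel. (if snd z < \<sigma> * fst z then wL else wR) * partial1 \<phi> z
                  + (if snd z < \<sigma> * fst z then fL else fR) * partial2 \<phi> z) = 0"
  shows "fR - fL = \<sigma> * (wR - wL)"
proof -
  obtain b :: "real \<Rightarrow> real" where b: "smooth_on UNIV b" "\<And>x. 0 \<le> b x" "\<And>x. b x \<noteq> 0 \<longleftrightarrow> \<bar>x\<bar> < 1"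
    using smooth_bump_exists by blast
  obtain b' where b': "\<And>x. (b has_real_derivative b' x) (at x)" and cb': "continuous_on UNIV b'"
    using smooth_on_real_derivative[OF b(1)] by blast
  have cb: "continuous_on UNIV b"
    using b' by (auto intro!: DERIV_isCont continuous_at_imp_continuous_on)
  have b0: "b x = 0" if "1 \<le> \<bar>x\<bar>" for x
    using b(3)[of x] that by simp
  have b'0: "b' x = 0" if "1 < \<bar>x\<bar>" for x
  proof -
    have "(b has_real_derivative 0) (at x)"
      by (rule has_field_derivative_transform_within_open[where f = "\<lambda>x. 0" and S = "- {-1..1}"])
         (use that in \<open>auto simp: b0\<close>)
    then show ?thesis using b' DERIV_unique by blast
  qed
  have ib: "integrable lborel b" "integrable lborel b'"
    using b0 b'0 by (auto intro!: integrable_continuous_compact_support[where r = 1] cb cb')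
  have FTC: "(LINT x|lborel. b' x * indicator {l..r} x) = b r - b l" if "l \<le> r" for l r
    by (rule integral_FTC_Icc_real) (use that b' cb' in \<open>auto simp: continuous_on_eq_continuous_at\<close>)
  \<comment> \<open>A two-valued factor is bounded by \<open>\<bar>c\<bar> + \<bar>d\<bar>\<close>,
    which gives the dominating function.\<close>
  have step: "integrable lborel (\<lambda>y. (if y < 0 then c else d) * g y)" if "integrable lborel g"
    for c d :: real and g :: "real \<Rightarrow> real"
  proof (rule Bochner_Integration.integrable_bound)
    show "integrable lborel (\<lambda>y. (\<bar>c\<bar> + \<bar>d\<bar>) * g y)" using that by simp
    show "(\<lambda>y. (if y < 0 then c else d) * g y) \<in> borel_measurable lborel"
      using borel_measurable_integrable[OF that] by measurable
  qed (auto simp: abs_mult intro!: mult_right_mono)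
  have b'_total: "(LINT y|lborel. b' y) = 0"
  proof -
    \<comment> \<open>Any interval containing the support in its interior would do; \<open>b\<close>
      vanishes at its ends.\<close>
    have "b' x * indicator {-2..2} x = b' x" for x
      using b'0[of x] by (cases "1 < \<bar>x\<bar>") (auto simp: indicator_def)
    then have "(LINT y|lborel. b' y) = (LINT y|lborel. b' y * indicator {-2..2} y)"
      by presburger
    then show ?thesis using FTC[of "-2" 2] b0[of 2] b0[of "-2"] by simp
  qed
  \<comment> \<open>On the support the step function is \<open>d\<close> plus \<open>c - d\<close>
    times the indicator of \<open>{-2..0}\<close>, except possibly at \<open>y = 0\<close>, hence
    the almost-everywhere argument. The constant part integrates to 0, the other to
    \<open>(c - d) * b 0\<close>.\<close>
  have b'_step: "(LINT y|lborel. (if y < 0 then c else d) * b' y) = (c - d) * b 0" for c d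
  proof -
    have "(LINT y|lborel. (if y < 0 then c else d) * b' y)
        = (LINT y|lborel. (c - d) * (b' y * indicator {-2..0} y) + d * b' y)"
    proof (rule integral_cong_AE)
      show "AE y in lborel. (if y < 0 then c else d) * b' y
          = (c - d) * (b' y * indicator {-2..0} y) + d * b' y"
        using AE_lborel_singleton[of 0]
      proof eventually_elim
        case (elim y)
        then show ?case
          using b'0[of y] by (cases "1 < \<bar>y\<bar>") (auto simp: indicator_def algebra_simps)
      qed
    qed (use borel_measurable_integrable[OF ib(2)] in measurable)
    also have "\<dots> = (c - d) * (LINT y|lborel. b' y * indicator {-2..0} y) + d * (LINT y|lborel. b' y)"
      by (subst Bochner_Integration.integral_add)
         (auto intro!: integrable_real_mult_indicator ib)
    also have "\<dots> = (c - d) * b 0"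
      using FTC[of "-2" 0] b0[of "-2"] b'_total by simp
    finally show ?thesis .
  qed
  have b_total: "(LINT y|lborel. b y) \<noteq> 0"
  proof
    assume "(LINT y|lborel. b y) = 0"
    then have "AE y in lborel. b y = 0"
      using integral_nonneg_eq_0_iff_AE[OF ib(1)] b(2) by simp
    then have "AE y in lborel. y \<notin> {-1<..<1::real}"
      by eventually_elim (use b(3) in \<open>auto simp: abs_less_iff\<close>)
    then have "emeasure lborel {-1<..<1::real} = 0"
      by (subst (asm) AE_iff_measurable[where N = "{-1<..<1}"]) auto
    then show False by simp
  qed
  \<comment> \<open>The shift by 2 moves the support to \<open>{1..3}\<close>, inside the half-plane
    of positive times.\<close>
  define a where "a t = b (t - 2)" for t
  define a' where "a' t = b' (t - 2)" for t
  have a': "(a has_real_derivative a' t) (at t)" for t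
  proof -
    have "((\<lambda>t. b (t - 2)) has_real_derivative b' (t - 2) * 1) (at t)"
      by (rule DERIV_chain2[OF b']) (auto intro!: derivative_eq_intros)
    then show ?thesis by (simp add: a_def[abs_def] a'_def)
  qed
  have ia: "integrable lborel a" "integrable lborel a'"
    using lborel_integrable_real_affine[OF ib(1), of 1 "-2"]
      lborel_integrable_real_affine[OF ib(2), of 1 "-2"]
    by (simp_all add: a_def[abs_def] a'_def[abs_def])
  have a_int: "(LINT t|lborel. a t) = (LINT y|lborel. b y)" "(LINT t|lborel. a' t) = 0"
    using lborel_integral_real_affine[of 1 b "-2"] lborel_integral_real_affine[of 1 b' "-2"] b'_total
    by (simp_all add: a_def a'_def)
  define \<phi> where "\<phi> z = a (fst z) * b (snd z - \<sigma> * fst z)" for z :: "real \<times> real"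
  have "test_function \<phi>"
    unfolding test_function_def
  proof
    have "bounded_linear (\<lambda>z::real \<times> real. snd z - \<sigma> * fst z)"
      by (intro bounded_linear_sub bounded_linear_snd bounded_linear_const_mult bounded_linear_fst)
    \<comment> \<open>The offsets \<open>- 2\<close> and \<open>0\<close> are written out to match
      the shape \<open>f (L z + c)\<close>.\<close>
    then have "smooth_on UNIV (\<lambda>z::real \<times> real. b (fst z + - 2) * b (snd z - \<sigma> * fst z + 0))"
      by (intro smooth_on_mult smooth_on_compose_affine b(1) bounded_linear_fst open_UNIV)
    then show "smooth_on UNIV \<phi>" by (simp add: \<phi>_def[abs_def] a_def)
    \<comment> \<open>The support is a rectangle in the coordinates \<open>(t, y)\<close>; the
      inverse shear carries it back to \<open>(t, x)\<close> as a continuous image of a compact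
      set.\<close>
    let ?K = "(\<lambda>p::real \<times> real. (fst p, snd p + \<sigma> * fst p)) ` ({1..3} \<times> {-1..1})"
    show "\<exists>K. compact K \<and> K \<subseteq> {0<..} \<times> UNIV \<and> (\<forall>z. z \<notin> K \<longrightarrow> \<phi> z = 0)"
    proof (intro exI conjI allI impI)
      show "compact ?K"
        by (intro compact_continuous_image compact_Times continuous_intros compact_Icc)
      fix z assume z: "z \<notin> ?K"
      show "\<phi> z = 0"
      proof (rule ccontr)
        assume "\<phi> z \<noteq> 0"
        then have "\<bar>fst z - 2\<bar> < 1" "\<bar>snd z - \<sigma> * fst z\<bar> < 1"
          by (auto simp: \<phi>_def a_def b(3))
        then have "z \<in> ?K"
          by (intro image_eqI[where x = "(fst z, snd z - \<sigma> * fst z)"]) auto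
        with z show False ..
      qed
    qed auto
  qed
  have D: "(\<phi> has_derivative (\<lambda>v. a' (fst z) * fst v * b (snd z - \<sigma> * fst z)
      + a (fst z) * (b' (snd z - \<sigma> * fst z) * (snd v - \<sigma> * fst v)))) (at z)" for z
    unfolding \<phi>_def[abs_def]
    by (auto intro!: derivative_eq_intros
        has_derivative_compose[OF _ a'[unfolded has_field_derivative_def]]
        has_derivative_compose[OF _ b'[unfolded has_field_derivative_def]] simp: algebra_simps)
  have partials: "partial1 \<phi> z = a' (fst z) * b (snd z - \<sigma> * fst z)
      - \<sigma> * (a (fst z) * b' (snd z - \<sigma> * fst z))"
    "partial2 \<phi> z = a (fst z) * b' (snd z - \<sigma> * fst z)" for z
    unfolding partial1_def partial2_def frechet_derivative_at[OF D, symmetric] by simp_all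
  \<comment> \<open>Terms are grouped by \<open>a' * b\<close> and \<open>a * b'\<close>. The
    \<open>- \<sigma>\<close> in the time derivative turns the flux \<open>f\<close> into
    \<open>f - \<sigma> * w\<close>, the flux relative to the moving discontinuity.\<close>
  let ?w = "\<lambda>y. (if y < 0 then wL else wR) * b y"
  let ?k = "\<lambda>y. (if y < 0 then fL - \<sigma> * wL else fR - \<sigma> * wR) * b' y"
  have "0 = (LINT z|lborel. a' (fst z) * ?w (snd z - \<sigma> * fst z) + a (fst z) * ?k (snd z - \<sigma> * fst z))"
    by (rule trans[OF weak[OF \<open>test_function \<phi>\<close>, symmetric] Bochner_Integration.integral_cong])
       (auto simp: partials algebra_simps)
  also have "\<dots> = (LINT t|lborel. a' t) * (LINT y|lborel. ?w y) + (LINT t|lborel. a t) * (LINT y|lborel. ?k y)"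
    using sheared_product_integral[OF ia(2) step[OF ib(1)], where \<sigma> = \<sigma>]
      sheared_product_integral[OF ia(1) step[OF ib(2)], where \<sigma> = \<sigma>]
    by (subst Bochner_Integration.integral_add) simp_all
  also have "\<dots> = (LINT y|lborel. b y) * (((fL - \<sigma> * wL) - (fR - \<sigma> * wR)) * b 0)"
    unfolding b'_step a_int by simp
  finally have "fL - \<sigma> * wL = fR - \<sigma> * wR" using b_total b(3)[of 0] by simp
  then show ?thesis by (simp add: algebra_simps)
qed

section \<open>Jump conditions for the two-fluid system\<close>

theorem proposition4p4:
  fixes E :: "phase \<Rightarrow> eos"
    and m :: "(state \<Rightarrow> real) \<Rightarrow> state \<Rightarrow> state \<Rightarrow> real"
    and W :: "wave_field \<Rightarrow> state \<Rightarrow> state \<Rightarrow> real \<Rightarrow> bool"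
    and UL UR :: state and \<sigma> :: real
  assumes "\<And>k. complete_eos (E k)"
    and "\<And>k. nonvanishing_fundamental_derivative (E k)"
    and "wave_association E W"
    and "shock E m W UL UR \<sigma>"
  shows "jump UL UR vf1 = 0 \<and>
    (\<forall>k. jump UL UR (\<lambda>U. vf U k * dens U k * (vel U k - \<sigma>)) = 0 \<and>
         jump UL UR (\<lambda>U. vf U k * dens U k * vel U k * (vel U k - \<sigma>))
           + jump UL UR (\<lambda>U. vf U k * pres E U k) = 0 \<and>
         jump UL UR (\<lambda>U. vf U k * dens U k * total_energy U k * (vel U k - \<sigma>))
           + jump UL UR (\<lambda>U. vf U k * pres E U k * vel U k) = 0)"
proof -
  have adm: "admissible E UL" "admissible E UR"
    using assms(4) by (auto simp: shock_def)
  obtain i where "acoustic i" "W i UL UR \<sigma>"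
    using assms(4) by (auto simp: shock_def)
  \<comment> \<open>A jump of the volume fraction would force the field to be
    \<open>Interfacial\<close>, which is not acoustic.\<close>
  then have vf1: "vf1 UL = vf1 UR"
    using assms(3) adm unfolding wave_association_def by (metis acoustic.simps(1))
  \<comment> \<open>The factor \<open>vf1 UR - vf1 UL\<close> is now 0, which kills the
    nonconservative right-hand side.\<close>
  have RH: "flux E q UR - flux E q UL = \<sigma> * (conserved q UR - conserved q UL)" for q
  proof (rule rankine_hugoniot)
    fix \<phi> assume "test_function \<phi>"
    then have "(LINT z|lborel. conserved q (two_state UL UR \<sigma> z) * partial1 \<phi> z
        + flux E q (two_state UL UR \<sigma> z) * partial2 \<phi> z) = 0"
      using assms(4) vf1 by (simp add: shock_def two_state_solution_def)
    then show "(LINT z|lborel. (if snd z < \<sigma> * fst z then conserved q UL else conserved q UR) * partial1 \<phi> z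
        + (if snd z < \<sigma> * fst z then flux E q UL else flux E q UR) * partial2 \<phi> z) = 0"
      by (simp add: two_state_def if_distrib)
  qed
  \<comment> \<open>Positive density permits cancelling in \<open>dens * (pres / dens)\<close>,
    splitting the enthalpy flux into transported energy and pressure work.\<close>
  have enthalpy: "vf U k * dens U k * total_enthalpy E U k * vel U k
      = vf U k * dens U k * total_energy U k * vel U k + vf U k * pres E U k * vel U k"
    if "admissible E U" for U k
  proof -
    have "dens U k \<noteq> 0" using that unfolding admissible_def by (metis less_irrefl)
    then show ?thesis by (simp add: total_enthalpy_def field_simps)
  qed
  show ?thesis
    \<comment> \<open>Each claim is flux minus \<open>\<sigma>\<close> times conserved quantity,
      with the pressure terms set apart.\<close>
    using vf1 RH[of "Mass _"] RH[of "Momentum _"] RH[of "Energy _"] enthalpy[OF adm(1)] enthalpy[OF adm(2)]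
    by (simp add: jump_def algebra_simps power2_eq_square)
qed

end
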